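(* Let $\overline{Q}$ be a bounded sublinear rate operator on $\mathscr{B}$. Then $(e^{t\overline{Q}})_{t\in\mathbb{R}_{\ge 0}}$ is a uniformly continuous semigroup of sublinear transition operators.
   Context: Let $\mathcal{X}$ be a nonempty countable (finite or countably infinite) set and let $\mathscr{B}$ be the real vector space of bounded functions $\mathcal{X}\to\mathbb{R}$, with norm $\|f\|_\infty=\sup\{|f(x)|: x\in\mathcal{X}\}$. Inequalities between functions are pointwise and a real number is identified with the corresponding constant function. An operator is a (possibly nonlinear) map $\mathscr{B}\to\mathscr{B}$; $I$ is the identity operator; sums and real multiples of operators are defined pointwise, products and powers are compositions. For an operator $A$, $\|A\|_{\mathrm s}=\sup\{\|Af\|_\infty/\|f\|_\infty : f\in\mathscr{B}, f\ne 0\}$; $A$ is bounded if $\|A\|_{\mathrm s}<+\infty$. On the vector space of bounded operators one uses the norm $\|A\|_{\mathrm b}=\|A0\|_\infty+\|A\|_{\mathrm s}$, and limits of bounded operators are with respect to this norm. A sublinear transition operator is an operator $\overline{T}$ such that $\overline{T}(\lambda f)=\lambda\overline{T}f$ for all $f\in\mathscr{B}$ and real $\lambda\ge 0$; $\overline{T}(f+g)\le\overline{T}f+\overline{T}g$ for all $f,g\in\mathscr{B}$; and $\overline{T}f\le\sup f$ for all $f\in\mathscr{B}$. A sublinear rate operator is an operator $\overline{Q}$ such that $\overline{Q}(\lambda f)=\lambda\overline{Q}f$ for all $f\in\mathscr{B}$ and real $\lambda\ge 0$; $\overline{Q}(f+g)\le\overline{Q}f+\overline{Q}g$ for all $f,g\in\mathscr{B}$;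 $\overline{Q}\mu=0$ for all constants $\mu\in\mathbb{R}$; and $[\overline{Q}f](x)\le 0$ for all $f\in\mathscr{B}$ and $x\in\mathcal{X}$ with $\sup f=f(x)\ge 0$. For a bounded sublinear rate operator $\overline{Q}$ and $t\ge 0$, $e^{t\overline{Q}}:=\lim_{n\to+\infty}(I+\frac{t}{n}\overline{Q})^n$ (this limit with respect to $\|\cdot\|_{\mathrm b}$ exists). A semigroup is a family $(S_t)_{t\in\mathbb{R}_{\ge0}}$ of operators with $S_0=I$ and $S_{s+t}=S_sS_t$ for all $s,t\ge 0$. A semigroup of bounded operators is uniformly continuous if $\lim_{s\to t}\|S_s-S_t\|_{\mathrm b}=0$ for all $t\ge 0$. *)

theory Defs
  imports "HOL-Analysis.Analysis"
begin

text \<open>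
  The countable set is the universe of a type \<^typ>\<open>'x\<close> carrying the discrete topology. Every function
  on it is then continuous, so \<^typ>\<open>'x \<Rightarrow>\<^sub>C real\<close> is exactly the space of bounded functions, and its
  library norm is the supremum norm; the first two lemmas confirm this.
\<close>

lemma bcontfun_discrete:
  "(bcontfun :: ('x::discrete_topology \<Rightarrow> real) set) = {f. bounded (range f)}"
  by (simp add: bcontfun_def)

lemma norm_bcontfun_eq_SUP:
  "norm (f :: 'x::topological_space \<Rightarrow>\<^sub>C real) = (SUP x. \<bar>f x\<bar>)"
  by (simp add: norm_bcontfun_def dist_bcontfun_def zero_bcontfun.rep_eq)

text \<open>Operators are arbitrary, possibly nonlinear, maps.\<close>

type_synonym 'x operator = "('x \<Rightarrow>\<^sub>C real) \<Rightarrow> ('x \<Rightarrow>\<^sub>C real)"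

text \<open>The suprema are taken in \<^typ>\<open>ereal\<close>, because an operator need not be bounded.\<close>

definition op_norm_s :: "('x::discrete_topology) operator \<Rightarrow> ereal" where
  "op_norm_s A = (SUP f \<in> {f. f \<noteq> 0}. ereal (norm (A f) / norm f))"

definition bounded_op :: "('x::discrete_topology) operator \<Rightarrow> bool" where
  "bounded_op A \<longleftrightarrow> op_norm_s A < \<infinity>"

definition op_norm_b :: "('x::discrete_topology) operator \<Rightarrow> ereal" where
  "op_norm_b A = ereal (norm (A 0)) + op_norm_s A"

definition op_diff :: "('x::discrete_topology) operator \<Rightarrow> 'x operator \<Rightarrow> 'x operator" where
  "op_diff A B = (\<lambda>f. A f - B f)"

definition op_tendsto ::
  "('i \<Rightarrow> ('x::discrete_topology) operator) \<Rightarrow> 'x operator \<Rightarrow> 'i filter \<Rightarrow> bool" where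
  "op_tendsto A L F \<longleftrightarrow> ((\<lambda>i. op_norm_b (op_diff (A i) L)) \<longlongrightarrow> 0) F"

definition op_lim :: "(nat \<Rightarrow> ('x::discrete_topology) operator) \<Rightarrow> 'x operator" where
  "op_lim A = (THE L. bounded_op L \<and> op_tendsto A L sequentially)"

definition pos_homogeneous :: "('x::discrete_topology) operator \<Rightarrow> bool" where
  "pos_homogeneous A \<longleftrightarrow> (\<forall>f. \<forall>c\<ge>0. A (c *\<^sub>R f) = c *\<^sub>R A f)"

definition subadditive_op :: "('x::discrete_topology) operator \<Rightarrow> bool" where
  "subadditive_op A \<longleftrightarrow> (\<forall>f g x. A (f + g) x \<le> A f x + A g x)"

definition sublinear_transition_operator :: "('x::discrete_topology) operator \<Rightarrow> bool" where
  "sublinear_transition_operator T \<longleftrightarrow>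
     pos_homogeneous T \<and> subadditive_op T \<and> (\<forall>f x. T f x \<le> (SUP y. f y))"

definition sublinear_rate_operator :: "('x::discrete_topology) operator \<Rightarrow> bool" where
  "sublinear_rate_operator Q \<longleftrightarrow>
     pos_homogeneous Q \<and> subadditive_op Q \<and>
     (\<forall>\<mu>. Q (const_bcontfun \<mu>) = 0) \<and>
     (\<forall>f x. (SUP y. apply_bcontfun f y) = f x \<and> f x \<ge> 0 \<longrightarrow> Q f x \<le> 0)"

text \<open>
  For \<open>n = 0\<close> the step size is \<open>t / 0 = 0\<close> and the power is the identity; this term does not affect
  the limit.
\<close>

definition exp_op :: "real \<Rightarrow> ('x::discrete_topology) operator \<Rightarrow> 'x operator" where
  "exp_op t Q = op_lim (\<lambda>n. (\<lambda>f. f + (t / real n) *\<^sub>R Q f) ^^ n)"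

text \<open>
  Families indexed by the nonnegative reals are functions on \<^typ>\<open>real\<close> whose values at negative
  arguments are ignored.
\<close>

definition op_semigroup :: "(real \<Rightarrow> ('x::discrete_topology) operator) \<Rightarrow> bool" where
  "op_semigroup S \<longleftrightarrow> S 0 = id \<and> (\<forall>s\<ge>0. \<forall>t\<ge>0. S (s + t) = S s \<circ> S t)"

definition uniformly_continuous_semigroup ::
  "(real \<Rightarrow> ('x::discrete_topology) operator) \<Rightarrow> bool" where
  "uniformly_continuous_semigroup S \<longleftrightarrow>
     op_semigroup S \<and> (\<forall>t\<ge>0. bounded_op (S t)) \<and>
     (\<forall>t\<ge>0. op_tendsto S (S t) (at t within {0..}))"

end

theory Submission
  imports Defs
begin

text \<open>
  If \<open>\<parallel>Q\<parallel> \<le> K\<close> and \<open>h K \<le> 1\<close>, then the Euler step \<open>I + h Q\<close> is a sublinear transition operator: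
  raising \<open>f\<close> at the single point \<open>x\<close> to the value \<open>sup f\<close> makes \<open>Q\<close> nonpositive at \<open>x\<close> and costs at
  most \<open>K (sup f - f x)\<close>. Sublinear transition operators are nonexpansive, so one-step errors add up:
  one step of length \<open>m k\<close> differs from \<open>m\<close> steps of length \<open>k\<close> by at most \<open>(m k K)\<^sup>2 \<parallel>f\<parallel>\<close>, hence \<open>n\<close>
  steps of length \<open>t / n\<close> form a Cauchy sequence with error \<open>(t K)\<^sup>2 / n \<parallel>f\<parallel>\<close>. The semigroup law is obtained
  by approximating the flows at \<open>s\<close>, \<open>t\<close> and \<open>s + t\<close> with numbers of steps of the same length
  \<open>h = s / n\<close>, namely \<open>n\<close>, \<open>\<lfloor>t / h\<rfloor>\<close> and their sum.
\<close>

section \<open>Bounded functions\<close>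

text \<open>A Cauchy sequence for the supremum distance is uniformly Cauchy, and a uniform limit of
  bounded continuous functions is again one.\<close>

lemma Cauchy_convergent_bcontfun:
  fixes F :: "nat \<Rightarrow> 'a::topological_space \<Rightarrow>\<^sub>C 'b::complete_space"
  assumes "Cauchy F"
  shows "convergent F"
proof -
  have "uniformly_Cauchy_on UNIV (\<lambda>n. apply_bcontfun (F n))"
  proof (rule uniformly_Cauchy_onI)
    fix e :: real assume "e > 0"
    then obtain M where "\<forall>m\<ge>M. \<forall>n\<ge>M. dist (F m) (F n) < e"
      using assms unfolding Cauchy_def by blast
    then show "\<exists>M. \<forall>x\<in>UNIV. \<forall>m\<ge>M. \<forall>n\<ge>M. dist (F m x) (F n x) < e"
      using dist_fun_lt_imp_dist_val_lt by blast
  qed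
  then obtain l where "uniform_limit UNIV (\<lambda>n. apply_bcontfun (F n)) l sequentially"
    using Cauchy_uniformly_convergent uniformly_convergent_on_def by blast
  then obtain l' where "F \<longlonglongrightarrow> l'"
    by (elim uniform_limit_bcontfunE) auto
  then show ?thesis
    by (rule convergentI)
qed

lemma tendsto_apply_bcontfun:
  fixes F :: "'i \<Rightarrow> 'a::topological_space \<Rightarrow>\<^sub>C 'b::metric_space"
  assumes "(F \<longlongrightarrow> f) A"
  shows "((\<lambda>i. F i x) \<longlongrightarrow> f x) A"
  using tendsto_bcontfun_uniform_limit[OF assms] by (rule tendsto_uniform_limitI) simp

lemma apply_bcontfun_le_SUP:
  fixes f :: "'a::topological_space \<Rightarrow>\<^sub>C real"
  shows "f x \<le> (SUP y. f y)"
  by (rule cSUP_upper) (auto intro: bounded_imp_bdd_above)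

lemma apply_bcontfun_le_norm:
  fixes f :: "'a::topological_space \<Rightarrow>\<^sub>C real"
  shows "f x \<le> norm f"
  using norm_bounded[of f x] by simp

lemma SUP_bcontfun_le_norm:
  fixes f :: "'a::topological_space \<Rightarrow>\<^sub>C real"
  shows "(SUP y. f y) \<le> norm f"
  by (rule cSUP_least) (auto simp: apply_bcontfun_le_norm)

lemma norm_diff_leI:
  fixes f g :: "'a::topological_space \<Rightarrow>\<^sub>C real"
  assumes "\<And>x. f x - g x \<le> c" "\<And>x. g x - f x \<le> c"
  shows "norm (f - g) \<le> c"
  by (rule norm_bound) (use assms in \<open>auto simp: abs_le_iff\<close>)

definition delta :: "'a \<Rightarrow> 'a::discrete_topology \<Rightarrow>\<^sub>C real" where
  "delta x = Bcontfun (\<lambda>y. if y = x then 1 else 0)"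

lemma apply_delta: "delta x y = (if y = x then 1 else 0)"
proof -
  have "(\<lambda>y. if y = x then 1 else 0 :: real) \<in> bcontfun"
    by (auto simp: bcontfun_discrete intro!: boundedI[where B = 1])
  then show ?thesis
    by (simp add: delta_def Bcontfun_inverse)
qed

lemma norm_delta_le: "norm (delta x) \<le> 1"
  by (rule norm_bound) (simp add: apply_delta)

section \<open>Operator norms\<close>

lemma op_norm_s_le:
  fixes A :: "('x::discrete_topology) operator"
  assumes "\<And>f. norm (A f) \<le> c * norm f"
  shows "op_norm_s A \<le> ereal c"
  unfolding op_norm_s_def
  by (rule SUP_least) (use assms in \<open>auto simp: divide_le_eq\<close>)

text \<open>An empty supremum in \<open>ereal\<close> would be minus infinity, so a nonzero function
  has to be exhibited.\<close>

lemma op_norm_s_nonneg: "0 \<le> op_norm_s (A :: ('x::discrete_topology) operator)"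
proof -
  have "delta (undefined :: 'x) undefined \<noteq> (0 :: 'x \<Rightarrow>\<^sub>C real) undefined"
    by (simp add: apply_delta)
  then have "delta (undefined :: 'x) \<noteq> 0"
    by metis
  then show ?thesis
    unfolding op_norm_s_def by (intro SUP_upper2[of "delta undefined"]) auto
qed

lemma op_norm_b_le:
  fixes A :: "('x::discrete_topology) operator"
  assumes "\<And>f. norm (A f) \<le> c * norm f"
  shows "op_norm_b A \<le> ereal c"
proof -
  have "A 0 = 0"
    using assms[of 0] by simp
  then show ?thesis
    using op_norm_s_le[OF assms] by (simp add: op_norm_b_def flip: zero_ereal_def)
qed

lemma op_norm_b_nonneg: "0 \<le> op_norm_b A"
  unfolding op_norm_b_def using op_norm_s_nonneg by (intro add_nonneg_nonneg) auto

lemma norm_le_op_norm_s: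
  assumes "f \<noteq> 0"
  shows "ereal (norm (A f) / norm f) \<le> op_norm_s A"
  unfolding op_norm_s_def using assms by (intro SUP_upper) auto

text \<open>The supremum does not see \<open>f = 0\<close>; there the bound comes from
  \<open>A 0 = 0\<close>.\<close>

lemma bounded_opE:
  assumes "bounded_op A" "A 0 = 0"
  obtains K where "\<And>f. norm (A f) \<le> K * norm f"
proof -
  obtain K where K: "op_norm_s A = ereal K"
    using assms op_norm_s_nonneg[of A] unfolding bounded_op_def by (cases "op_norm_s A") auto
  have "norm (A f) \<le> K * norm f" for f
    using norm_le_op_norm_s[of f A] assms(2) by (cases "f = 0") (auto simp: K divide_le_eq)
  then show ?thesis
    by (rule that)
qed

text \<open>The summand \<open>norm (A 0)\<close> of the norm controls the value at zero, and
  \<open>op_norm_s\<close> controls all other values.\<close>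

lemma op_tendsto_pointwise:
  assumes "op_tendsto A L F"
  shows "((\<lambda>i. A i f) \<longlongrightarrow> L f) F"
proof (cases "f = 0")
  case True
  have "ereal (norm (A i f - L f)) \<le> op_norm_b (op_diff (A i) L)" for i
    unfolding True op_norm_b_def using op_norm_s_nonneg[of "op_diff (A i) L"]
    by (simp add: op_diff_def ereal_le_add_self)
  then have "((\<lambda>i. ereal (norm (A i f - L f))) \<longlongrightarrow> 0) F"
    by (intro tendsto_sandwich[OF _ _ tendsto_const assms[unfolded op_tendsto_def]]) auto
  then show ?thesis
    by (simp only: zero_ereal_def lim_ereal tendsto_norm_zero_iff Lim_null[symmetric])
next
  case False
  have "ereal (norm (A i f - L f) / norm f) \<le> op_norm_b (op_diff (A i) L)" for i
    unfolding op_norm_b_def using norm_le_op_norm_s[OF False, of "op_diff (A i) L"]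
    by (simp add: op_diff_def add_increasing)
  then have "((\<lambda>i. ereal (norm (A i f - L f) / norm f)) \<longlongrightarrow> 0) F"
    by (intro tendsto_sandwich[OF _ _ tendsto_const assms[unfolded op_tendsto_def]]) auto
  then have "((\<lambda>i. norm (A i f - L f) / norm f * norm f) \<longlongrightarrow> 0 * norm f) F"
    unfolding zero_ereal_def lim_ereal by (rule tendsto_mult_right)
  then have "((\<lambda>i. norm (A i f - L f)) \<longlongrightarrow> 0) F"
    using False by simp
  then show ?thesis
    by (simp only: tendsto_norm_zero_iff Lim_null[symmetric])
qed

text \<open>Pointwise limits are unique, so the definite description in \<open>op_lim\<close> is met
  by \<open>L\<close> alone.\<close>

lemma op_lim_eqI:
  assumes "bounded_op L" "op_tendsto A L sequentially"
  shows "op_lim A = L"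
  unfolding op_lim_def
proof (rule the_equality)
  fix L' assume "bounded_op L' \<and> op_tendsto A L' sequentially"
  then show "L' = L"
    using assms(2) op_tendsto_pointwise by (metis LIMSEQ_unique ext)
qed (use assms in blast)

lemma op_tendstoI:
  assumes "\<forall>\<^sub>F i in F. \<forall>f. norm (A i f - L f) \<le> c i * norm f" "(c \<longlongrightarrow> 0) F"
  shows "op_tendsto A L F"
  unfolding op_tendsto_def
proof (rule tendsto_sandwich[OF _ _ tendsto_const])
  show "\<forall>\<^sub>F i in F. 0 \<le> op_norm_b (op_diff (A i) L)"
    by (simp add: op_norm_b_nonneg)
  show "\<forall>\<^sub>F i in F. op_norm_b (op_diff (A i) L) \<le> ereal (c i)"
    using assms(1) by eventually_elim (auto intro!: op_norm_b_le simp: op_diff_def)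
  show "((\<lambda>i. ereal (c i)) \<longlongrightarrow> 0) F"
    using assms(2) by (simp add: zero_ereal_def)
qed

section \<open>Sublinear transition operators\<close>

context
  fixes T :: "('x::discrete_topology) operator"
  assumes T: "sublinear_transition_operator T"
begin

lemma transition_scaleR: "0 \<le> c \<Longrightarrow> T (c *\<^sub>R f) = c *\<^sub>R T f"
  using T by (simp add: sublinear_transition_operator_def pos_homogeneous_def)

lemma transition_add: "T (f + g) x \<le> T f x + T g x"
  using T by (simp add: sublinear_transition_operator_def subadditive_op_def)

lemma transition_le_SUP: "T f x \<le> (SUP y. f y)"
  using T by (simp add: sublinear_transition_operator_def)

text \<open>Subadditivity gives \<open>T f\<close> \<le> \<open>T (f - g) + T g\<close>, and
  \<open>T (f - g)\<close> is at most the supremum of \<open>f - g\<close>.\<close>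

lemma transition_mono:
  fixes f g :: "'x \<Rightarrow>\<^sub>C real"
  assumes "\<And>y. f y \<le> g y"
  shows "T f x \<le> T g x"
proof -
  have "T (f - g) x \<le> 0"
    by (rule order_trans[OF transition_le_SUP cSUP_least]) (use assms in auto)
  then show ?thesis
    using transition_add[of "f - g" g x] by simp
qed

lemma transition_nonexpansive: "norm (T f - T g) \<le> norm (f - g)"
proof (rule norm_diff_leI)
  have *: "T f x - T g x \<le> norm (f - g)" for f g x
    using transition_add[of "f - g" g x] transition_le_SUP[of "f - g" x]
      SUP_bcontfun_le_norm[of "f - g"]
    by simp
  fix x
  show "T f x - T g x \<le> norm (f - g)"
    by (rule *)
  show "T g x - T f x \<le> norm (f - g)"
    using *[of g x f] by (simp add: norm_minus_commute)
qed

lemma transition_norm_le: "norm (T f) \<le> norm f"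
  using transition_nonexpansive[of f 0] transition_scaleR[of 0 0] by simp

end

lemma transition_id: "sublinear_transition_operator id"
  by (simp add: sublinear_transition_operator_def pos_homogeneous_def subadditive_op_def
      apply_bcontfun_le_SUP)

lemma transition_comp:
  assumes S: "sublinear_transition_operator S" and T: "sublinear_transition_operator T"
  shows "sublinear_transition_operator (S \<circ> T)"
proof -
  have "S (T (f + g)) x \<le> S (T f) x + S (T g) x" for f g x
    using transition_mono[OF S, of "T (f + g)" "T f + T g"] transition_add[OF T]
      transition_add[OF S, of "T f" "T g"]
    by (smt (verit) plus_bcontfun.rep_eq)
  moreover have "S (T f) x \<le> (SUP y. f y)" for f x
    by (rule order_trans[OF transition_le_SUP[OF S] cSUP_least])
      (auto intro: transition_le_SUP[OF T])
  ultimately show ?thesis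
    by (auto simp: sublinear_transition_operator_def pos_homogeneous_def subadditive_op_def
        transition_scaleR[OF S] transition_scaleR[OF T])
qed

lemma transition_funpow:
  "sublinear_transition_operator T \<Longrightarrow> sublinear_transition_operator (T ^^ n)"
  by (induction n) (auto simp: transition_id transition_comp)

text \<open>All three axioms are equations or weak inequalities between values, hence survive
  pointwise limits. They are asked only eventually, since Euler powers satisfy them once the step is
  small.\<close>

lemma transition_limit:
  fixes S :: "('x::discrete_topology) operator"
  assumes lim: "\<And>f. (\<lambda>n. T n f) \<longlonglongrightarrow> S f"
    and T: "\<forall>\<^sub>F n in sequentially. sublinear_transition_operator (T n)"
  shows "sublinear_transition_operator S"
proof -
  note limx = tendsto_apply_bcontfun[OF lim]
  have "S (c *\<^sub>R f) = c *\<^sub>R S f" if "0 \<le> c" for c f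
  proof (rule LIMSEQ_unique[OF lim])
    show "(\<lambda>n. T n (c *\<^sub>R f)) \<longlonglongrightarrow> c *\<^sub>R S f"
      by (rule Lim_transform_eventually[OF tendsto_scaleR[OF tendsto_const lim[of f]]])
        (use T in eventually_elim, simp add: transition_scaleR that)
  qed
  moreover have "S (f + g) x \<le> S f x + S g x" for f g x
    by (rule tendsto_le[OF _ tendsto_add[OF limx limx] limx])
      (simp, use T in eventually_elim, simp add: transition_add)
  moreover have "S f x \<le> (SUP y. f y)" for f x
    by (rule tendsto_le[OF _ tendsto_const limx])
      (simp, use T in eventually_elim, simp add: transition_le_SUP)
  ultimately show ?thesis
    by (auto simp: sublinear_transition_operator_def pos_homogeneous_def subadditive_op_def)
qed

section \<open>Accumulation of errors under iteration\<close>

lemma funpow_displacement: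
  fixes T :: "('x::discrete_topology) operator"
  assumes T: "sublinear_transition_operator T" and d: "\<And>f. norm (T f - f) \<le> e * norm f"
    and "0 \<le> e"
  shows "norm ((T ^^ n) f - f) \<le> n * e * norm f"
proof (induction n)
  case (Suc n)
  have "norm ((T ^^ Suc n) f - (T ^^ n) f) \<le> e * norm ((T ^^ n) f)"
    using d by simp
  also have "\<dots> \<le> e * norm f"
    using transition_norm_le[OF transition_funpow[OF T]] \<open>0 \<le> e\<close> by (intro mult_left_mono)
  finally show ?case
    using Suc norm_triangle_ineq[of "(T ^^ Suc n) f - (T ^^ n) f" "(T ^^ n) f - f"]
    by (simp add: algebra_simps)
qed simp

text \<open>Compare through \<open>A ((B ^^ n) f)\<close>: \<open>A\<close> does not amplify the old
  error, and the new one is measured at \<open>(B ^^ n) f\<close>, whose norm is at most that of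
  \<open>f\<close>.\<close>

lemma funpow_diff_le:
  fixes A B :: "('x::discrete_topology) operator"
  assumes A: "sublinear_transition_operator A" and B: "sublinear_transition_operator B"
    and d: "\<And>f. norm (A f - B f) \<le> e * norm f" and "0 \<le> e"
  shows "norm ((A ^^ n) f - (B ^^ n) f) \<le> n * e * norm f"
proof (induction n)
  case (Suc n)
  have "norm (A ((A ^^ n) f) - A ((B ^^ n) f)) \<le> n * e * norm f"
    using transition_nonexpansive[OF A] Suc order_trans by blast
  moreover have "norm (A ((B ^^ n) f) - B ((B ^^ n) f)) \<le> e * norm f"
    using d[of "(B ^^ n) f"] transition_norm_le[OF transition_funpow[OF B, of n], of f] \<open>0 \<le> e\<close>
    by (meson mult_left_mono order_trans)
  ultimately show ?case
    using norm_triangle_ineq[of "A ((A ^^ n) f) - A ((B ^^ n) f)"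
        "A ((B ^^ n) f) - B ((B ^^ n) f)"]
    by (simp add: algebra_simps)
qed simp

section \<open>Euler steps\<close>

text \<open>A fixed real bound \<open>K\<close> keeps the estimates out of
  \<open>ereal\<close>.\<close>

locale bounded_rate_operator =
  fixes Q :: "('x::discrete_topology) operator" and K :: real
  assumes rate: "sublinear_rate_operator Q" and Q_bound: "norm (Q f) \<le> K * norm f"
begin

definition euler :: "real \<Rightarrow> 'x operator" where
  "euler h = (\<lambda>f. f + h *\<^sub>R Q f)"

lemma Q_scaleR: "0 \<le> c \<Longrightarrow> Q (c *\<^sub>R f) = c *\<^sub>R Q f"
  using rate by (simp add: sublinear_rate_operator_def pos_homogeneous_def)

lemma Q_add: "Q (f + g) x \<le> Q f x + Q g x"
  using rate by (simp add: sublinear_rate_operator_def subadditive_op_def)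

lemma Q_const: "Q (const_bcontfun \<mu>) = 0"
  using rate by (simp add: sublinear_rate_operator_def)

lemma Q_nonpos:
  fixes f :: "'x \<Rightarrow>\<^sub>C real"
  shows "(SUP y. f y) = f x \<Longrightarrow> 0 \<le> f x \<Longrightarrow> Q f x \<le> 0"
  using rate by (simp add: sublinear_rate_operator_def)

lemma K_nonneg: "0 \<le> K"
proof -
  have "norm (const_bcontfun 1 :: 'x \<Rightarrow>\<^sub>C real) > 0"
    using apply_bcontfun_le_norm[of "const_bcontfun 1" "undefined :: 'x"]
    by (simp del: zero_less_norm_iff)
  then show ?thesis
    using Q_bound[of "const_bcontfun 1"] norm_ge_zero[of "Q (const_bcontfun 1)"]
    by (metis less_le_not_le mult_neg_pos not_le order_trans)
qed

text \<open>Although \<open>Q\<close> is nonlinear, subadditivity bounds \<open>Q f - Q g\<close> by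
  \<open>Q (f - g)\<close> pointwise, and the roles can be exchanged.\<close>

lemma Q_lipschitz: "norm (Q f - Q g) \<le> K * norm (f - g)"
proof (rule norm_diff_leI)
  have *: "Q f x - Q g x \<le> K * norm (f - g)" for f g x
    using Q_add[of "f - g" g x] apply_bcontfun_le_norm[of "Q (f - g)" x] Q_bound[of "f - g"]
    by simp
  fix x
  show "Q f x - Q g x \<le> K * norm (f - g)"
    by (rule *)
  show "Q g x - Q f x \<le> K * norm (f - g)"
    using *[of g x f] by (simp add: norm_minus_commute)
qed

lemma Q_le_SUP_diff: "Q f x \<le> K * ((SUP y. f y) - f x)"
proof -
  define M where "M = (SUP y. f y)"
  define a where "a = M - f x"
  \<comment> \<open>Subtracting the supremum brings the value at the raised point \<open>x\<close>
    to exactly 0, the supremum of \<open>g\<close>, so \<open>Q_nonpos\<close> applies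
    there.\<close>
  define g where "g = f - const_bcontfun M + a *\<^sub>R delta x"
  have le: "f y \<le> M" for y
    unfolding M_def by (rule apply_bcontfun_le_SUP)
  then have "a \<ge> 0"
    by (simp add: a_def)
  have gx: "g x = 0"
    by (simp add: g_def a_def apply_delta)
  have "g y \<le> 0" for y
    using le[of y] by (simp add: g_def a_def apply_delta)
  then have "(SUP y. g y) = g x"
    using apply_bcontfun_le_SUP[of g x] cSUP_least[of UNIV "apply_bcontfun g" 0] gx
    by (auto intro: antisym)
  then have "Q g x \<le> 0"
    using gx by (intro Q_nonpos) auto
  \<comment> \<open>The sign stays with \<open>delta x\<close>, because \<open>Q\<close> is
    homogeneous for nonnegative factors only.\<close>
  moreover have "Q (a *\<^sub>R - delta x) x \<le> K * a"
  proof -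
    have "Q (- delta x) x \<le> K"
      using apply_bcontfun_le_norm[of "Q (- delta x)" x] Q_bound[of "- delta x"]
        mult_left_mono[OF norm_delta_le[of x] K_nonneg]
      by simp
    then show ?thesis
      using \<open>a \<ge> 0\<close> by (simp only: Q_scaleR) (simp add: mult.commute[of K] mult_left_mono)
  qed
  moreover have "f = (g + a *\<^sub>R - delta x) + const_bcontfun M"
    by (simp add: g_def)
  then have "Q f x \<le> Q (g + a *\<^sub>R - delta x) x"
    using Q_add[of "g + a *\<^sub>R - delta x" "const_bcontfun M" x] by (simp add: Q_const)
  ultimately show ?thesis
    using Q_add[of g "a *\<^sub>R - delta x" x] by (simp add: a_def M_def)
qed

lemma transition_euler:
  assumes "0 \<le> h" "h * K \<le> 1"
  shows "sublinear_transition_operator (euler h)"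
proof -
  have "euler h (c *\<^sub>R f) = c *\<^sub>R euler h f" if "0 \<le> c" for c f
    using that by (simp add: euler_def Q_scaleR scaleR_add_right)
  moreover have "euler h (f + g) x \<le> euler h f x + euler h g x" for f g x
    using mult_left_mono[OF Q_add[of f g x] assms(1)] by (simp add: euler_def algebra_simps)
  moreover have "euler h f x \<le> (SUP y. f y)" for f x
  proof -
    have "h * Q f x \<le> h * K * ((SUP y. f y) - f x)"
      using mult_left_mono[OF Q_le_SUP_diff[of f x] assms(1)] by (simp add: mult.assoc)
    \<comment> \<open>The step restriction \<open>h * K\<close> \<le> \<open>1\<close> enters here,
      with a nonnegative gap between supremum and value.\<close>
    also have "\<dots> \<le> (SUP y. f y) - f x"
      using mult_right_mono[OF assms(2), of "(SUP y. f y) - f x"] apply_bcontfun_le_SUP[of f x]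
      by simp
    finally show ?thesis
      by (simp add: euler_def)
  qed
  ultimately show ?thesis
    by (simp add: sublinear_transition_operator_def pos_homogeneous_def subadditive_op_def)
qed

lemma euler_diff: "norm (euler h f - euler k f) \<le> \<bar>h - k\<bar> * K * norm f"
proof -
  have "euler h f - euler k f = (h - k) *\<^sub>R Q f"
    by (simp add: euler_def scaleR_diff_left)
  then show ?thesis
    using mult_left_mono[OF Q_bound[of f], of "\<bar>h - k\<bar>"] by (simp add: mult.assoc)
qed

lemma euler_0: "euler 0 = id"
  by (auto simp: euler_def)

text \<open>The small steps evaluate \<open>Q\<close> along the moving iterate, the long step always
  at \<open>f\<close>. After \<open>m\<close> steps the iterate is within
  \<open>m * (k * K) * norm f\<close> of \<open>f\<close>, so the next step adds an error of at most
  \<open>m * (k * K)\<^sup>2 * norm f\<close>.\<close>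

lemma euler_subdivide:
  assumes "0 \<le> k" "k * K \<le> 1"
  shows "norm ((euler k ^^ m) f - euler (m * k) f) \<le> (m * k * K)\<^sup>2 * norm f"
proof (induction m)
  case 0
  then show ?case by (simp add: euler_0)
next
  case (Suc m)
  let ?u = "(euler k ^^ m) f"
  have "norm (?u - f) \<le> m * (k * K) * norm f"
    using euler_diff[of k _ 0] assms K_nonneg
    by (intro funpow_displacement transition_euler) (auto simp: euler_0)
  then have "norm (Q ?u - Q f) \<le> K * (m * (k * K) * norm f)"
    using Q_lipschitz[of ?u f] K_nonneg by (meson mult_left_mono order_trans)
  then have "norm (k *\<^sub>R (Q ?u - Q f)) \<le> k * (K * (m * (k * K) * norm f))"
    using assms by (simp add: mult_left_mono)
  also have "\<dots> = m * (k * K)\<^sup>2 * norm f"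
    by (simp add: power2_eq_square)
  finally have *: "norm (k *\<^sub>R (Q ?u - Q f)) \<le> m * (k * K)\<^sup>2 * norm f" .
  have "(euler k ^^ Suc m) f - euler (Suc m * k) f
      = (?u - euler (m * k) f) + k *\<^sub>R (Q ?u - Q f)"
    by (simp add: euler_def algebra_simps)
  then have "norm ((euler k ^^ Suc m) f - euler (Suc m * k) f)
      \<le> (m * k * K)\<^sup>2 * norm f + m * (k * K)\<^sup>2 * norm f"
    using Suc * norm_triangle_ineq[of "?u - euler (m * k) f" "k *\<^sub>R (Q ?u - Q f)"] by simp
  also have "\<dots> = (m\<^sup>2 + m) * ((k * K)\<^sup>2 * norm f)"
    by (simp add: power_mult_distrib algebra_simps)
  also have "\<dots> \<le> (Suc m)\<^sup>2 * ((k * K)\<^sup>2 * norm f)"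
    by (intro mult_right_mono) (auto simp: power2_eq_square)
  also have "\<dots> = (Suc m * k * K)\<^sup>2 * norm f"
    by (simp add: power_mult_distrib)
  finally show ?case .
qed

text \<open>Group the short steps into \<open>n\<close> blocks of \<open>m\<close>; each block
  replaces one step of length \<open>h\<close>, and the block errors add up.\<close>

lemma euler_refine:
  assumes "0 \<le> h" "h * K \<le> 1" "0 < m"
  shows "norm ((euler (h / m) ^^ (m * n)) f - (euler h ^^ n) f) \<le> n * (h * K)\<^sup>2 * norm f"
proof -
  have "h * K / m \<le> h * K / 1"
    using assms K_nonneg by (intro divide_left_mono) auto
  then have k: "0 \<le> h / m" "h / m * K \<le> 1"
    using assms by auto
  have "norm ((euler (h / m) ^^ m) f - euler h f) \<le> (h * K)\<^sup>2 * norm f" for f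
    using euler_subdivide[OF k, of m f] assms by simp
  then have "norm (((euler (h / m) ^^ m) ^^ n) f - (euler h ^^ n) f) \<le> n * (h * K)\<^sup>2 * norm f"
    using assms k by (intro funpow_diff_le transition_funpow transition_euler) auto
  then show ?thesis
    by (simp add: funpow_mult mult.commute)
qed

section \<open>The flow\<close>

text \<open>Both sides are compared with their common refinement, \<open>n * l\<close> steps of
  length \<open>t / (n * l)\<close>.\<close>

lemma euler_powers_diff:
  assumes "0 \<le> t" "0 < n" "0 < l" "t * K \<le> n" "t * K \<le> l"
  shows "norm ((euler (t / n) ^^ n) f - (euler (t / l) ^^ l) f)
    \<le> ((t * K)\<^sup>2 / n + (t * K)\<^sup>2 / l) * norm f"
proof -
  have *: "norm ((euler (t / (n * l)) ^^ (n * l)) f - (euler (t / n) ^^ n) f)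
      \<le> (t * K)\<^sup>2 / n * norm f" if "0 < n" "0 < l" "t * K \<le> n" for n l :: nat
    using euler_refine[of "t / n" l n f] that assms(1)
    by (simp add: field_simps power2_eq_square)
  let ?u = "(euler (t / (n * l)) ^^ (n * l)) f"
  have "norm (?u - (euler (t / n) ^^ n) f) \<le> (t * K)\<^sup>2 / n * norm f"
    "norm (?u - (euler (t / l) ^^ l) f) \<le> (t * K)\<^sup>2 / l * norm f"
    using *[of n l] *[of l n] assms by (simp_all only: mult.commute)
  then show ?thesis
    using norm_triangle_ineq4[of "?u - (euler (t / l) ^^ l) f" "?u - (euler (t / n) ^^ n) f"]
    by (simp add: distrib_right)
qed

text \<open>A pointwise limit, available before convergence in the operator norm is known;
  \<open>exp_op_eq_flow\<close> identifies it with the exponential.\<close>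

definition flow :: "real \<Rightarrow> 'x operator" where
  "flow t f = lim (\<lambda>n. (euler (t / n) ^^ n) f)"

lemma euler_powers_tendsto:
  assumes "0 \<le> t"
  shows "(\<lambda>n. (euler (t / n) ^^ n) f) \<longlonglongrightarrow> flow t f"
proof -
  let ?c = "(t * K)\<^sup>2 * norm f"
  have "Cauchy (\<lambda>n. (euler (t / n) ^^ n) f)"
  proof (rule CauchyI)
    fix e :: real assume "e > 0"
    \<comment> \<open>The three bounds make the step length well defined, the steps small enough,
      and each of the two error terms less than \<open>e / 2\<close>.\<close>
    obtain N where N: "real N > max 1 (max (t * K) (2 * ?c / e))"
      using reals_Archimedean2 by blast
    have "norm ((euler (t / n) ^^ n) f - (euler (t / l) ^^ l) f) < e"
      if "n \<ge> N" "l \<ge> N" for n l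
    proof -
      have *: "?c / m < e / 2" if "m \<ge> N" for m
      proof -
        have "2 * ?c / e < m" "0 < real m"
          using N that by linarith+
        then show ?thesis
          using \<open>e > 0\<close> by (simp add: field_simps)
      qed
      have "norm ((euler (t / n) ^^ n) f - (euler (t / l) ^^ l) f)
          \<le> ((t * K)\<^sup>2 / n + (t * K)\<^sup>2 / l) * norm f"
        using N that assms by (intro euler_powers_diff) linarith+
      also have "\<dots> = ?c / n + ?c / l"
        by (simp add: algebra_simps)
      finally show ?thesis
        using *[OF that(1)] *[OF that(2)] by linarith
    qed
    then show "\<exists>M. \<forall>m\<ge>M. \<forall>n\<ge>M.
        norm ((euler (t / m) ^^ m) f - (euler (t / n) ^^ n) f) < e"
      by blast
  qed
  then show ?thesis
    unfolding flow_def by (simp add: Cauchy_convergent_bcontfun flip: convergent_LIMSEQ_iff)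
qed

lemma eventually_small_step:
  "\<forall>\<^sub>F n in sequentially. 0 < n \<and> t * K \<le> real n"
  using eventually_gt_at_top[of 0] eventually_ge_at_top[of "nat \<lceil>t * K\<rceil>"]
  by eventually_elim linarith

lemma transition_euler_power:
  assumes "0 \<le> t" "0 < n" "t * K \<le> real n"
  shows "sublinear_transition_operator (euler (t / n) ^^ n)"
  using assms by (intro transition_funpow transition_euler) (auto simp: divide_le_eq)

lemma transition_flow:
  assumes "0 \<le> t"
  shows "sublinear_transition_operator (flow t)"
  using euler_powers_tendsto[OF assms]
proof (rule transition_limit)
  show "\<forall>\<^sub>F n in sequentially. sublinear_transition_operator (euler (t / n) ^^ n)"
    using eventually_small_step[of t]
    by eventually_elim (use assms transition_euler_power in auto)
qed

text \<open>Let \<open>l\<close> tend to infinity in \<open>euler_powers_diff\<close>. The rate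
  depends on \<open>f\<close> only through its norm, which later gives convergence in the operator
  norm.\<close>

lemma flow_error:
  assumes "0 \<le> t" "0 < n" "t * K \<le> n"
  shows "norm ((euler (t / n) ^^ n) f - flow t f) \<le> (t * K)\<^sup>2 / n * norm f"
proof (rule tendsto_le)
  show "(\<lambda>l. norm ((euler (t / n) ^^ n) f - (euler (t / l) ^^ l) f))
      \<longlonglongrightarrow> norm ((euler (t / n) ^^ n) f - flow t f)"
    by (intro tendsto_intros euler_powers_tendsto assms)
  have "(\<lambda>l. ((t * K)\<^sup>2 / n + (t * K)\<^sup>2 * (1 / l)) * norm f)
      \<longlonglongrightarrow> ((t * K)\<^sup>2 / n + (t * K)\<^sup>2 * 0) * norm f"
    by (intro tendsto_intros lim_1_over_n)
  then show "(\<lambda>l. ((t * K)\<^sup>2 / n + (t * K)\<^sup>2 / l) * norm f)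
      \<longlonglongrightarrow> (t * K)\<^sup>2 / n * norm f"
    by simp
  show "\<forall>\<^sub>F l in sequentially. norm ((euler (t / n) ^^ n) f - (euler (t / l) ^^ l) f)
      \<le> ((t * K)\<^sup>2 / n + (t * K)\<^sup>2 / l) * norm f"
    using eventually_small_step[of t] by eventually_elim (use assms euler_powers_diff in auto)
qed simp

lemma flow_0: "flow 0 = id"
proof
  fix f
  have "(euler 0 ^^ n) f = f" for n
    by (simp add: euler_0)
  then show "flow 0 f = id f"
    using euler_powers_tendsto[of 0 f] by (simp add: LIMSEQ_const_iff)
qed

text \<open>This is \<open>flow_error\<close> at time \<open>m * h\<close>, since
  \<open>(m * h * K)\<^sup>2 / m = m * (h * K)\<^sup>2\<close>; for \<open>m = 0\<close> both
  operators are the identity.\<close>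

lemma euler_power_flow:
  assumes "0 \<le> h" "h * K \<le> 1"
  shows "norm ((euler h ^^ m) f - flow (m * h) f) \<le> m * (h * K)\<^sup>2 * norm f"
proof (cases "m = 0")
  case False
  then show ?thesis
    using flow_error[of "m * h" m f] assms
    by (simp add: power2_eq_square mult.assoc mult.left_commute mult_left_le)
qed (simp add: flow_0)

text \<open>Single steps of lengths \<open>s / n\<close> and \<open>t / n\<close> differ by a factor
  \<open>\<bar>s - t\<bar> / n * K\<close>; \<open>n\<close> of them add up to a bound free of
  \<open>n\<close>.\<close>

lemma flow_lipschitz:
  assumes "0 \<le> s" "0 \<le> t"
  shows "norm (flow s f - flow t f) \<le> \<bar>s - t\<bar> * K * norm f"
proof (rule tendsto_upperbound)
  show "(\<lambda>n. norm ((euler (s / n) ^^ n) f - (euler (t / n) ^^ n) f))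
      \<longlonglongrightarrow> norm (flow s f - flow t f)"
    by (intro tendsto_intros euler_powers_tendsto assms)
  show "\<forall>\<^sub>F n in sequentially.
      norm ((euler (s / n) ^^ n) f - (euler (t / n) ^^ n) f) \<le> \<bar>s - t\<bar> * K * norm f"
    using eventually_small_step[of s] eventually_small_step[of t]
  proof eventually_elim
    case (elim n)
    have "norm (euler (s / n) f - euler (t / n) f) \<le> \<bar>s - t\<bar> / n * K * norm f" for f
      using euler_diff[of "s / n" f "t / n"] by (simp flip: diff_divide_distrib)
    then have "norm ((euler (s / n) ^^ n) f - (euler (t / n) ^^ n) f)
        \<le> n * (\<bar>s - t\<bar> / n * K) * norm f"
      using assms elim K_nonneg
      by (intro funpow_diff_le transition_euler) (auto simp: divide_le_eq)
    then show ?case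
      using elim by simp
  qed
qed simp

lemma eventually_step_less:
  assumes "h \<longlonglongrightarrow> 0"
  shows "\<forall>\<^sub>F n in sequentially. h n * K < 1"
  using order_tendstoD(2)[OF tendsto_mult_right[OF assms, of K], of 1] by simp

text \<open>The step length need not divide \<open>t\<close>, so different times can share one step
  length. The discretization error vanishes with \<open>h n\<close> as \<open>m n * h n\<close>
  converges, and \<open>flow_lipschitz\<close> absorbs the mismatch in time.\<close>

lemma euler_tendsto_flow:
  assumes h: "h \<longlonglongrightarrow> 0" "\<And>n. 0 \<le> h n" and mh: "(\<lambda>n. m n * h n) \<longlonglongrightarrow> t"
    and "0 \<le> t"
  shows "(\<lambda>n. (euler (h n) ^^ m n) f) \<longlonglongrightarrow> flow t f"
proof (rule Lim_null[THEN iffD2, OF Lim_null_comparison])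
  show "\<forall>\<^sub>F n in sequentially. norm ((euler (h n) ^^ m n) f - flow t f)
      \<le> m n * h n * h n * K\<^sup>2 * norm f + \<bar>m n * h n - t\<bar> * K * norm f"
    using eventually_step_less[OF h(1)]
  proof eventually_elim
    case (elim n)
    have "norm ((euler (h n) ^^ m n) f - flow (m n * h n) f) \<le> m n * h n * h n * K\<^sup>2 * norm f"
      using euler_power_flow[of "h n" "m n" f] h(2) elim
      by (simp add: power2_eq_square algebra_simps)
    moreover have "norm (flow (m n * h n) f - flow t f) \<le> \<bar>m n * h n - t\<bar> * K * norm f"
      using h(2) assms(4) by (intro flow_lipschitz) auto
    ultimately show ?case
      using norm_triangle_ineq[of "(euler (h n) ^^ m n) f - flow (m n * h n) f"
          "flow (m n * h n) f - flow t f"]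
      by simp
  qed
  have "(\<lambda>n. m n * h n * h n * K\<^sup>2 * norm f + \<bar>m n * h n - t\<bar> * K * norm f)
      \<longlonglongrightarrow> t * 0 * K\<^sup>2 * norm f + \<bar>t - t\<bar> * K * norm f"
    by (intro tendsto_intros h mh)
  then show "(\<lambda>n. m n * h n * h n * K\<^sup>2 * norm f + \<bar>m n * h n - t\<bar> * K * norm f)
      \<longlonglongrightarrow> 0"
    by simp
qed

section \<open>Semigroup law\<close>

lemma flow_add:
  assumes "0 \<le> s" "0 \<le> t"
  shows "flow (s + t) f = flow s (flow t f)"
proof (cases "s = 0")
  case True
  then show ?thesis by (simp add: flow_0)
next
  case False
  \<comment> \<open>\<open>Suc n\<close> avoids division by zero, so that every step length is
    positive.\<close>
  define h where "h n = s / Suc n" for n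
  define m where "m n = nat \<lfloor>t / h n\<rfloor>" for n
  have h_pos: "0 < h n" for n
    using False assms by (simp add: h_def)
  have h0: "h \<longlonglongrightarrow> 0"
    unfolding h_def using LIMSEQ_Suc[OF lim_const_over_n[of s]] by simp
  have sh: "(\<lambda>n. Suc n * h n) \<longlonglongrightarrow> s"
    by (simp add: h_def del: of_nat_Suc)
  have mh: "(\<lambda>n. m n * h n) \<longlonglongrightarrow> t"
  proof (rule tendsto_sandwich)
    \<comment> \<open>Rounding down loses less than one step, so \<open>m n * h n\<close> lies
      between \<open>t - h n\<close> and \<open>t\<close>.\<close>
    have *: "m n \<le> t / h n" "t / h n \<le> m n + 1" for n
      using assms(2) h_pos[of n] by (auto simp: m_def) linarith
    show "\<forall>\<^sub>F n in sequentially. t - h n \<le> m n * h n"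
      using *(2) h_pos by (auto simp: pos_divide_le_eq algebra_simps)
    show "\<forall>\<^sub>F n in sequentially. m n * h n \<le> t"
      using *(1) h_pos by (simp add: pos_le_divide_eq)
    show "(\<lambda>n. t - h n) \<longlonglongrightarrow> t"
      using tendsto_diff[OF tendsto_const h0] by simp
  qed simp
  have "(\<lambda>n. (Suc n + m n) * h n) \<longlonglongrightarrow> s + t"
    using tendsto_add[OF sh mh] by (simp add: algebra_simps)
  then have *: "(\<lambda>n. (euler (h n) ^^ (Suc n + m n)) f) \<longlonglongrightarrow> flow (s + t) f"
    using assms h_pos by (intro euler_tendsto_flow h0) (auto intro: less_imp_le)
  have flow_t: "(\<lambda>n. (euler (h n) ^^ m n) f) \<longlonglongrightarrow> flow t f"
    using assms h_pos by (intro euler_tendsto_flow h0 mh) (auto intro: less_imp_le)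
  have flow_s: "(\<lambda>n. (euler (h n) ^^ Suc n) (flow t f)) \<longlonglongrightarrow> flow s (flow t f)"
    using assms h_pos by (intro euler_tendsto_flow h0 sh) (auto intro: less_imp_le)
  \<comment> \<open>Split off the outer \<open>Suc n\<close> steps: being nonexpansive, they pass on
    at most the error of the inner \<open>m n\<close> steps against \<open>flow t f\<close>.\<close>
  have "(\<lambda>n. (euler (h n) ^^ (Suc n + m n)) f - (euler (h n) ^^ Suc n) (flow t f)) \<longlonglongrightarrow> 0"
  proof (rule Lim_null_comparison)
    show "(\<lambda>n. norm ((euler (h n) ^^ m n) f - flow t f)) \<longlonglongrightarrow> 0"
      using flow_t by (simp only: tendsto_norm_zero_iff Lim_null[symmetric])
    show "\<forall>\<^sub>F n in sequentially.
        norm ((euler (h n) ^^ (Suc n + m n)) f - (euler (h n) ^^ Suc n) (flow t f))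
        \<le> norm ((euler (h n) ^^ m n) f - flow t f)"
      using eventually_step_less[OF h0]
    proof eventually_elim
      case (elim n)
      then have "sublinear_transition_operator (euler (h n) ^^ Suc n)"
        using h_pos by (intro transition_funpow transition_euler) (auto intro: less_imp_le)
      then show ?case
        unfolding funpow_add o_apply by (rule transition_nonexpansive)
    qed
  qed
  from tendsto_add[OF this flow_s]
  have "(\<lambda>n. (euler (h n) ^^ (Suc n + m n)) f) \<longlonglongrightarrow> flow s (flow t f)"
    by simp
  with * show ?thesis
    by (rule LIMSEQ_unique)
qed

section \<open>The flow as exponential, and uniform continuity\<close>

lemma bounded_op_flow:
  assumes "0 \<le> t"
  shows "bounded_op (flow t)"
proof -
  have "op_norm_s (flow t) \<le> ereal 1"
    using transition_norm_le[OF transition_flow[OF assms]] by (intro op_norm_s_le) simp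
  then show ?thesis
    unfolding bounded_op_def by auto
qed

lemma exp_op_eq_flow:
  assumes "0 \<le> t"
  shows "exp_op t Q = flow t"
  unfolding exp_op_def euler_def[symmetric]
proof (rule op_lim_eqI[OF bounded_op_flow[OF assms] op_tendstoI])
  show "\<forall>\<^sub>F n in sequentially. \<forall>f. norm ((euler (t / n) ^^ n) f - flow t f)
      \<le> (t * K)\<^sup>2 / n * norm f"
    using eventually_small_step[of t] by eventually_elim (use assms flow_error in auto)
qed (rule lim_const_over_n)

lemma op_tendsto_flow:
  assumes "0 \<le> t"
  shows "op_tendsto flow (flow t) (at t within {0..})"
proof (rule op_tendstoI)
  show "\<forall>\<^sub>F s in at t within {0..}. \<forall>f. norm (flow s f - flow t f) \<le> \<bar>s - t\<bar> * K * norm f"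
    using assms flow_lipschitz by (auto simp: eventually_at_filter)
  have "((\<lambda>s. \<bar>s - t\<bar> * K) \<longlongrightarrow> \<bar>t - t\<bar> * K) (at t within {0..})"
    by (intro tendsto_intros)
  then show "((\<lambda>s. \<bar>s - t\<bar> * K) \<longlongrightarrow> 0) (at t within {0..})"
    by simp
qed

text \<open>\<open>exp_op_eq_flow\<close> covers nonnegative times only, so the limit is transferred
  along the filter within \<open>{0..}\<close>.\<close>

lemma op_tendsto_exp_op:
  assumes "0 \<le> t"
  shows "op_tendsto (\<lambda>t. exp_op t Q) (exp_op t Q) (at t within {0..})"
proof -
  have "\<forall>\<^sub>F s in at t within {0..}. op_norm_b (op_diff (flow s) (flow t))
      = op_norm_b (op_diff (exp_op s Q) (exp_op t Q))"
    using assms by (auto simp: eventually_at_filter exp_op_eq_flow)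
  then show ?thesis
    using op_tendsto_flow[OF assms] unfolding op_tendsto_def
    by (rule Lim_transform_eventually[rotated])
qed

end

theorem proposition16:
  fixes Q :: "('x::{countable, discrete_topology}) operator"
  assumes "sublinear_rate_operator Q"
    and "bounded_op Q"
  shows "uniformly_continuous_semigroup (\<lambda>t. exp_op t Q) \<and>
    (\<forall>t\<ge>0. sublinear_transition_operator (exp_op t Q))"
proof -
  \<comment> \<open>The clause on constants at 0; it supplies the value at zero that
    \<open>bounded_opE\<close> asks for.\<close>
  have "Q 0 = 0"
    using assms(1) by (metis const_bcontfun_0_eq_0 sublinear_rate_operator_def)
  with assms(2) obtain K where "\<And>f. norm (Q f) \<le> K * norm f"
    by (rule bounded_opE) blast
  then interpret bounded_rate_operator Q K
    by unfold_locales (use assms in auto)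
  have "op_semigroup (\<lambda>t. exp_op t Q)"
    unfolding op_semigroup_def by (auto simp: exp_op_eq_flow flow_0 flow_add)
  then show ?thesis
    unfolding uniformly_continuous_semigroup_def
    using op_tendsto_exp_op by (simp add: exp_op_eq_flow bounded_op_flow transition_flow)
qed

end
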